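(* For all $\delta\in(0,1]$ and $\xi\in(0,\delta)$, we have $$\mathcal{M}_-(\delta)\le \mathcal{M}(\delta)\le \mathcal{M}_-(\delta-\xi).$$ Moreover, $\mathcal{M}(\delta)=\mathcal{M}_-(\delta)$ at all but countably many points $\delta\in(0,1]$.
   Context: Setting: $(\Theta,d)$ is a non-empty pseudo-metric space (i.e. $d:\Theta\times\Theta\to[0,\infty)$ is symmetric, satisfies $d(\theta,\theta)=0$ and the triangle inequality, but $d(\theta_1,\theta_2)=0$ is allowed for $\theta_1\ne\theta_2$), equipped with the topology induced by the open balls of $d$ and the corresponding Borel $\sigma$-algebra. For each $\theta\in\Theta$, $\mathcal{P}_\theta$ is a family of probability measures on a measurable space $(\mathcal{X},\mathcal{A})$, and $\mathcal{P}_\Theta:=\{\mathcal{P}_\theta:\theta\in\Theta\}$. The function $g:[0,\infty)\to[0,\infty)$ is increasing (non-decreasing) and the loss is $L(\theta_1,\theta_2):=g(d(\theta_1,\theta_2))$. $\hat\Theta$ is the set of all measurable functions (estimators) from $\mathcal{X}$ to $\Theta$. For $\delta\in(0,1]$, $\mathrm{Quantile}(1-\delta;P_\theta,L(\hat\theta,\theta)):=\inf\{r\in[0,\infty):P_\theta\{L(\hat\theta,\theta)\le r\}\ge 1-\delta\}$. Minimax $(1-\delta)$th quantile: $\mathcal{M}(\delta):=\inf_{\hat\theta\in\hat\Theta}\sup_{\theta\in\Theta}\sup_{P_\theta\in\mathcal{P}_\theta}\mathrm{Quantile}(1-\delta;P_\theta,L(\hat\theta,\theta))$. Lower minimax $(1-\delta)$th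 quantile: $\mathcal{M}_-(\delta):=\inf\{r\in[0,\infty):\inf_{\hat\theta\in\hat\Theta}\sup_{\theta\in\Theta}\sup_{P_\theta\in\mathcal{P}_\theta}P_\theta\{L(\hat\theta,\theta)>r\}\le\delta\}$. *)

theory Defs
  imports "HOL-Probability.Probability"
begin

text \<open>Same carrier conventions as the library locale \<open>Metric_space\<close>, without separation.\<close>

locale pseudometric_space =
  fixes M :: "'a set" and d :: "'a \<Rightarrow> 'a \<Rightarrow> real"
  assumes nonneg: "\<And>x y. x \<in> M \<Longrightarrow> y \<in> M \<Longrightarrow> 0 \<le> d x y"
    and refl_zero: "\<And>x. x \<in> M \<Longrightarrow> d x x = 0"
    and commute: "\<And>x y. x \<in> M \<Longrightarrow> y \<in> M \<Longrightarrow> d x y = d y x"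
    and triangle: "\<And>x y z. x \<in> M \<Longrightarrow> y \<in> M \<Longrightarrow> z \<in> M \<Longrightarrow> d x z \<le> d x y + d y z"

definition pm_ball :: "'a set \<Rightarrow> ('a \<Rightarrow> 'a \<Rightarrow> real) \<Rightarrow> 'a \<Rightarrow> real \<Rightarrow> 'a set" where
  "pm_ball M d x r = {y \<in> M. d x y < r}"

definition pm_topology :: "'a set \<Rightarrow> ('a \<Rightarrow> 'a \<Rightarrow> real) \<Rightarrow> 'a topology" where
  "pm_topology M d = topology_generated_by {pm_ball M d x r | x r. x \<in> M \<and> 0 < r}"

definition pm_borel :: "'a set \<Rightarrow> ('a \<Rightarrow> 'a \<Rightarrow> real) \<Rightarrow> 'a measure" where
  "pm_borel M d = sigma M {U. openin (pm_topology M d) U}"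

text \<open>
  Quantiles and suprema of quantiles take values in the extended half-line, so that the infimum
  of the empty set is infinite and a supremum over an empty or unbounded family makes sense
  (an empty supremum being zero).
\<close>

definition quantile :: "real \<Rightarrow> 'x measure \<Rightarrow> ('x \<Rightarrow> real) \<Rightarrow> ennreal" where
  "quantile q p f =
     (INF r \<in> {r. 0 \<le> r \<and> emeasure p {x \<in> space p. f x \<le> r} \<ge> ennreal q}. ennreal r)"

definition estimators ::
  "'x measure \<Rightarrow> 't set \<Rightarrow> ('t \<Rightarrow> 't \<Rightarrow> real) \<Rightarrow> ('x \<Rightarrow> 't) set" where
  "estimators X \<Theta> d = measurable X (pm_borel \<Theta> d)"

definition loss :: "(real \<Rightarrow> real) \<Rightarrow> ('t \<Rightarrow> 't \<Rightarrow> real) \<Rightarrow> 't \<Rightarrow> 't \<Rightarrow> real" where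
  "loss g d \<theta>1 \<theta>2 = g (d \<theta>1 \<theta>2)"

definition minimax_quantile ::
  "'x measure \<Rightarrow> 't set \<Rightarrow> ('t \<Rightarrow> 't \<Rightarrow> real) \<Rightarrow> (real \<Rightarrow> real) \<Rightarrow> ('t \<Rightarrow> 'x measure set)
    \<Rightarrow> real \<Rightarrow> ennreal" where
  "minimax_quantile X \<Theta> d g \<P> \<delta> =
     (INF est \<in> estimators X \<Theta> d. SUP \<theta> \<in> \<Theta>. SUP p \<in> \<P> \<theta>.
        quantile (1 - \<delta>) p (\<lambda>x. loss g d (est x) \<theta>))"

definition lower_minimax_quantile ::
  "'x measure \<Rightarrow> 't set \<Rightarrow> ('t \<Rightarrow> 't \<Rightarrow> real) \<Rightarrow> (real \<Rightarrow> real) \<Rightarrow> ('t \<Rightarrow> 'x measure set)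
    \<Rightarrow> real \<Rightarrow> ennreal" where
  "lower_minimax_quantile X \<Theta> d g \<P> \<delta> =
     (INF r \<in> {r. 0 \<le> r \<and>
        (INF est \<in> estimators X \<Theta> d. SUP \<theta> \<in> \<Theta>. SUP p \<in> \<P> \<theta>.
           emeasure p {x \<in> space p. loss g d (est x) \<theta> > r}) \<le> ennreal \<delta>}. ennreal r)"

end

(* If every quantile is below r, then the same estimator has all tail probabilities at r at most
   \<delta>, so M_-(\<delta>) \<le> M(\<delta>). Conversely, an infimum of worst-case tail probabilities that is at most
   \<delta>' < \<delta> need not be attained, but some estimator gets below \<delta>; this costs the gap \<xi>.
   By the two bounds, the intervals (M_-(\<delta>), M(\<delta>)) are pairwise disjoint, so only countably many
   are non-empty. *)
theory Submission
  imports Defs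
begin

text \<open>Side condition of \<open>sets_measure_of\<close>: the generating family must lie in the
  power set of the carrier before \<open>sets (pm_borel M d)\<close> can be identified with the
  generated sigma-algebra.\<close>

lemma pm_borel_sets_subset: "{U. openin (pm_topology M d) U} \<subseteq> Pow M"
proof -
  have "topspace (pm_topology M d) \<subseteq> M"
    by (auto simp: pm_topology_def pm_ball_def)
  then show ?thesis
    by (blast dest: openin_subset)
qed

lemma space_pm_borel [simp]: "space (pm_borel M d) = M"
  by (simp add: pm_borel_def space_measure_of_conv)

lemma pm_ball_in_pm_borel:
  assumes "x \<in> M" and "0 < r"
  shows "pm_ball M d x r \<in> sets (pm_borel M d)"
proof -
  have "openin (pm_topology M d) (pm_ball M d x r)"
    unfolding pm_topology_def by (rule topology_generated_by_Basis) (use assms in blast)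
  then show ?thesis
    by (auto simp: pm_borel_def sets_measure_of[OF pm_borel_sets_subset])
qed

text \<open>By symmetry the strict sublevel sets are balls around \<open>z\<close>; for levels
  \<open>a \<le> 0\<close> they are empty because \<open>d\<close> is nonnegative.\<close>

lemma (in pseudometric_space) measurable_dist_pm_borel:
  assumes "z \<in> M"
  shows "(\<lambda>y. d y z) \<in> borel_measurable (pm_borel M d)"
proof (rule borel_measurableI_less)
  fix a
  have "{y \<in> M. d y z < a} = (if 0 < a then pm_ball M d z a else {})"
    using nonneg[OF _ assms] commute[OF assms] by (auto simp: pm_ball_def not_less intro: order_trans)
  then show "{y \<in> space (pm_borel M d). d y z < a} \<in> sets (pm_borel M d)"
    using pm_ball_in_pm_borel[OF assms] by auto
qed

lemma (in pseudometric_space) measurable_loss: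
  assumes "mono_on {0..} g" and "z \<in> M" and "f \<in> measurable N (pm_borel M d)"
  shows "(\<lambda>x. loss g d (f x) z) \<in> borel_measurable N"
proof -
  \<comment> \<open>Monotonicity of \<open>g\<close> is known only on the half-line. Extending it to
    the left by the constant \<open>g 0\<close> gives a function monotone on all reals, hence Borel,
    and distances never see the change.\<close>
  have "mono (\<lambda>t. g (max 0 t))"
    using assms(1) by (auto simp: mono_on_def intro!: monoI)
  then have "(\<lambda>t. g (max 0 t)) \<in> borel_measurable borel"
    by (rule borel_measurable_mono)
  with measurable_dist_pm_borel[OF assms(2)] assms(3)
  have "(\<lambda>x. g (max 0 (d (f x) z))) \<in> borel_measurable N"
    by (auto intro: measurable_compose)
  moreover have "loss g d (f x) z = g (max 0 (d (f x) z))" if "x \<in> space N" for x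
    using nonneg[OF _ assms(2)] measurable_space[OF assms(3) that] by (simp add: loss_def max_def)
  ultimately show ?thesis
    by (simp cong: measurable_cong)
qed

text \<open>The two events are complementary. For \<delta> > 1 the left bound truncates to 0 in
  \<open>ennreal\<close>, and both sides hold trivially.\<close>

lemma (in prob_space) emeasure_le_ge_iff_gt_le:
  fixes f :: "'a \<Rightarrow> real"
  assumes "f \<in> borel_measurable M" and "0 \<le> \<delta>"
  shows "ennreal (1 - \<delta>) \<le> emeasure M {x \<in> space M. f x \<le> r} \<longleftrightarrow>
         emeasure M {x \<in> space M. r < f x} \<le> ennreal \<delta>"
proof -
  have "{x \<in> space M. r < f x} = space M - {x \<in> space M. f x \<le> r}"
    by auto
  moreover have "{x \<in> space M. f x \<le> r} \<in> events"
    using assms(1) by measurable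
  ultimately have "prob {x \<in> space M. r < f x} = 1 - prob {x \<in> space M. f x \<le> r}"
    by (simp add: prob_compl)
  then show ?thesis
    using assms(2) by (auto simp: emeasure_eq_measure)
qed

text \<open>Strictness yields a level \<open>s < r\<close> admissible in the quantile, so the
  infimum need not be attained; raising the level from \<open>s\<close> to \<open>r\<close> only
  shrinks the tail event.\<close>

lemma (in prob_space) emeasure_gt_le_of_quantile_less:
  fixes f :: "'a \<Rightarrow> real"
  assumes "f \<in> borel_measurable M" and "0 \<le> \<delta>" and "quantile (1 - \<delta>) M f < ennreal r"
  shows "emeasure M {x \<in> space M. r < f x} \<le> ennreal \<delta>"
proof -
  obtain s where "0 \<le> s" "ennreal (1 - \<delta>) \<le> emeasure M {x \<in> space M. f x \<le> s}"
    "ennreal s < ennreal r"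
    using assms(3) by (auto simp: quantile_def INF_less_iff)
  then have "s < r" and "emeasure M {x \<in> space M. s < f x} \<le> ennreal \<delta>"
    using emeasure_le_ge_iff_gt_le[OF assms(1,2)] by (auto simp: ennreal_less_iff)
  moreover have "emeasure M {x \<in> space M. r < f x} \<le> emeasure M {x \<in> space M. s < f x}"
    by (rule emeasure_mono) (use \<open>s < r\<close> assms(1) in auto)
  ultimately show ?thesis
    by order
qed

lemma (in prob_space) quantile_le_of_emeasure_gt_le:
  fixes f :: "'a \<Rightarrow> real"
  assumes "f \<in> borel_measurable M" and "0 \<le> \<delta>" and "0 \<le> r"
    and "emeasure M {x \<in> space M. r < f x} \<le> ennreal \<delta>"
  shows "quantile (1 - \<delta>) M f \<le> ennreal r"
  unfolding quantile_def
  by (rule INF_lower) (use assms emeasure_le_ge_iff_gt_le[OF assms(1,2)] in auto)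

text \<open>A rational chosen from each gap between \<open>F x\<close> and \<open>G x\<close> gives
  an injection of \<open>A\<close> into the rationals, since gaps at different points do not
  overlap.\<close>

lemma countable_strict_drops:
  fixes F G :: "real \<Rightarrow> ennreal"
  assumes "\<And>x. x \<in> A \<Longrightarrow> F x < G x"
    and "\<And>x y. \<lbrakk>x \<in> A; y \<in> A; x < y\<rbrakk> \<Longrightarrow> G y \<le> F x"
  shows "countable A"
proof -
  have "\<exists>q::rat. F x < real_of_rat q \<and> real_of_rat q < G x" if "x \<in> A" for x
    using ennreal_rat_dense[OF assms(1)[OF that]] by auto
  then obtain q :: "real \<Rightarrow> rat" where
    q: "\<And>x. x \<in> A \<Longrightarrow> F x < real_of_rat (q x) \<and> real_of_rat (q x) < G x"
    by metis
  \<comment> \<open>The chain is \<open>q y < G y \<le> F x < q x\<close>, so \<open>q\<close> is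
    strictly decreasing on \<open>A\<close>.\<close>
  have "q x \<noteq> q y" if "x \<in> A" "y \<in> A" "x < y" for x y
    using q[of x] q[of y] assms(2)[OF that] that by (metis order.strict_trans1 order.asym)
  then have "inj_on q A"
    by (metis inj_onI linorder_neqE)
  then show ?thesis
    using countableI' countable_image_inj_on by blast
qed

theorem theorem4:
  fixes \<Theta> :: "'t set" and d :: "'t \<Rightarrow> 't \<Rightarrow> real" and g :: "real \<Rightarrow> real"
    and X :: "'x measure" and \<P> :: "'t \<Rightarrow> 'x measure set"
  assumes "pseudometric_space \<Theta> d" and "\<Theta> \<noteq> {}"
    and "mono_on {0..} g" and "\<And>t. 0 \<le> t \<Longrightarrow> 0 \<le> g t"
    and "\<And>\<theta> p. \<theta> \<in> \<Theta> \<Longrightarrow> p \<in> \<P> \<theta> \<Longrightarrow> prob_space p \<and> sets p = sets X"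
  shows "(\<forall>\<delta>\<in>{0<..1}. \<forall>\<xi>\<in>{0<..<\<delta>}.
            lower_minimax_quantile X \<Theta> d g \<P> \<delta> \<le> minimax_quantile X \<Theta> d g \<P> \<delta> \<and>
            minimax_quantile X \<Theta> d g \<P> \<delta> \<le> lower_minimax_quantile X \<Theta> d g \<P> (\<delta> - \<xi>)) \<and>
         countable {\<delta>\<in>{0<..1}.
            minimax_quantile X \<Theta> d g \<P> \<delta> \<noteq> lower_minimax_quantile X \<Theta> d g \<P> \<delta>}"
proof -
  interpret pseudometric_space \<Theta> d
    by fact
  \<comment> \<open>Estimators are measurable with respect to \<open>X\<close>; equality of the
    sigma-algebras carries this over to each \<open>p\<close>.\<close>
  have meas: "(\<lambda>x. loss g d (est x) \<theta>) \<in> borel_measurable p"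
    if "est \<in> estimators X \<Theta> d" "\<theta> \<in> \<Theta>" "p \<in> \<P> \<theta>" for est \<theta> p
    using that assms(5)[OF that(2,3)]
    by (intro measurable_loss assms(3)) (auto simp: estimators_def cong: measurable_cong_sets)
  have prob: "prob_space p" if "\<theta> \<in> \<Theta>" "p \<in> \<P> \<theta>" for \<theta> p
    using assms(5)[OF that] by simp
  have lower: "lower_minimax_quantile X \<Theta> d g \<P> \<delta> \<le> minimax_quantile X \<Theta> d g \<P> \<delta>"
    if "0 < \<delta>" for \<delta>
  \<comment> \<open>Working with \<open>c\<close> strictly above the minimax quantile makes it
    possible to pick an actual estimator whose worst quantile is below \<open>c\<close>. An infinite
    \<open>c\<close> is trivial.\<close>
  proof (rule dense_ge)
    fix c assume c: "minimax_quantile X \<Theta> d g \<P> \<delta> < c"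
    show "lower_minimax_quantile X \<Theta> d g \<P> \<delta> \<le> c"
    proof (cases c)
      case (real r)
      obtain est where est: "est \<in> estimators X \<Theta> d"
        and less: "(SUP \<theta>\<in>\<Theta>. SUP p\<in>\<P> \<theta>. quantile (1 - \<delta>) p (\<lambda>x. loss g d (est x) \<theta>)) < ennreal r"
        using c real by (auto simp: minimax_quantile_def INF_less_iff)
      have "emeasure p {x \<in> space p. r < loss g d (est x) \<theta>} \<le> ennreal \<delta>"
        if \<theta>: "\<theta> \<in> \<Theta>" and p: "p \<in> \<P> \<theta>" for \<theta> p
      proof (rule prob_space.emeasure_gt_le_of_quantile_less[OF prob[OF \<theta> p] meas[OF est \<theta> p]])
        have "quantile (1 - \<delta>) p (\<lambda>x. loss g d (est x) \<theta>) \<le>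
          (SUP \<theta>\<in>\<Theta>. SUP p\<in>\<P> \<theta>. quantile (1 - \<delta>) p (\<lambda>x. loss g d (est x) \<theta>))"
          using \<theta> p by (intro SUP_upper2[OF \<theta>] SUP_upper2[OF p]) auto
        with less show "quantile (1 - \<delta>) p (\<lambda>x. loss g d (est x) \<theta>) < ennreal r"
          by order
      qed (use \<open>0 < \<delta>\<close> in auto)
      then have "(INF est\<in>estimators X \<Theta> d. SUP \<theta>\<in>\<Theta>. SUP p\<in>\<P> \<theta>.
          emeasure p {x \<in> space p. r < loss g d (est x) \<theta>}) \<le> ennreal \<delta>"
        by (intro INF_lower2[OF est] SUP_least)
      then show ?thesis
        unfolding lower_minimax_quantile_def using real by (auto intro: INF_lower)
    qed simp
  qed
  have upper: "minimax_quantile X \<Theta> d g \<P> \<delta> \<le> lower_minimax_quantile X \<Theta> d g \<P> \<delta>'"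
    if "0 < \<delta>'" "\<delta>' < \<delta>" for \<delta> \<delta>'
    unfolding lower_minimax_quantile_def
  proof (rule INF_greatest, clarify)
    fix r :: real
    assume r: "0 \<le> r"
    assume "(INF est\<in>estimators X \<Theta> d. SUP \<theta>\<in>\<Theta>. SUP p\<in>\<P> \<theta>.
        emeasure p {x \<in> space p. r < loss g d (est x) \<theta>}) \<le> ennreal \<delta>'"
    \<comment> \<open>The strict gap turns a bound on the infimum over estimators into a bound, by
      \<delta>, for one particular estimator.\<close>
    also have "ennreal \<delta>' < ennreal \<delta>"
      using that by (simp add: ennreal_less_iff)
    finally obtain est where est: "est \<in> estimators X \<Theta> d"
      and less: "(SUP \<theta>\<in>\<Theta>. SUP p\<in>\<P> \<theta>.
        emeasure p {x \<in> space p. r < loss g d (est x) \<theta>}) < ennreal \<delta>"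
      by (auto simp: INF_less_iff)
    have "quantile (1 - \<delta>) p (\<lambda>x. loss g d (est x) \<theta>) \<le> ennreal r"
      if \<theta>: "\<theta> \<in> \<Theta>" and p: "p \<in> \<P> \<theta>" for \<theta> p
    proof (rule prob_space.quantile_le_of_emeasure_gt_le[OF prob[OF \<theta> p] meas[OF est \<theta> p] _ r])
      have "emeasure p {x \<in> space p. r < loss g d (est x) \<theta>} \<le>
        (SUP \<theta>\<in>\<Theta>. SUP p\<in>\<P> \<theta>. emeasure p {x \<in> space p. r < loss g d (est x) \<theta>})"
        using \<theta> p by (intro SUP_upper2[OF \<theta>] SUP_upper2[OF p]) auto
      with less show "emeasure p {x \<in> space p. r < loss g d (est x) \<theta>} \<le> ennreal \<delta>"
        by order
    qed (use \<open>0 < \<delta>'\<close> \<open>\<delta>' < \<delta>\<close> in simp)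
    then show "minimax_quantile X \<Theta> d g \<P> \<delta> \<le> ennreal r"
      unfolding minimax_quantile_def by (intro INF_lower2[OF est] SUP_least)
  qed
  \<comment> \<open>\<open>lower\<close> makes each discrepancy a strict gap; \<open>upper\<close>,
    applied to two exceptional points \<open>x < y\<close>, puts the gap at \<open>y\<close> below
    the gap at \<open>x\<close>.\<close>
  have "countable {\<delta>\<in>{0<..1}.
      minimax_quantile X \<Theta> d g \<P> \<delta> \<noteq> lower_minimax_quantile X \<Theta> d g \<P> \<delta>}"
    by (rule countable_strict_drops[where F = "lower_minimax_quantile X \<Theta> d g \<P>"
          and G = "minimax_quantile X \<Theta> d g \<P>"])
      (use lower upper in \<open>auto simp: less_le\<close>)
  \<comment> \<open>Here \<open>upper\<close> is used at \<open>\<delta> - \<xi>\<close>, which is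
    positive because \<open>\<xi> < \<delta>\<close>.\<close>
  then show ?thesis
    using lower upper by auto
qed

end
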